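(* Let $(\Omega,\mathcal F,\mathbb P)$ be a complete probability space, let $\mathcal H$ be a real Hilbert space, and let $v:\Omega\to\mathcal H$ be Bochner integrable. If $v$ admits a Karhunen-Loève expansion (KLE), then $v\in L^2(\Omega,\mathcal H)$.
   Context: A function $v:\Omega\to\mathcal H$ is simple if $\mathbb P$-a.e. $v(\omega)=\sum_{n=1}^N \mathbb I_{E_n}(\omega)e_n$ with $E_n\in\mathcal F$, $e_n\in\mathcal H$; it is Bochner measurable if there are simple functions $v_n$ with $\|v_n(\omega)-v(\omega)\|_{\mathcal H}\to 0$ for $\mathbb P$-a.e. $\omega$. $L^2(\Omega,\mathcal H)$ is the Hilbert space of ($\mathbb P$-a.e. equivalence classes of) Bochner measurable $v:\Omega\to\mathcal H$ with $\int_\Omega\|v(\omega)\|_{\mathcal H}^2\,d\mathbb P<\infty$, with inner product $\langle u,v\rangle_{L^2(\Omega,\mathcal H)}=\int_\Omega\langle u(\omega),v(\omega)\rangle_{\mathcal H}\,d\mathbb P$. $L^2(\Omega)$ is the space of (classes of) real-valued square-integrable $\mathcal F$-measurable functions. $\mathbb E(v)=\int_\Omega v\,d\mathbb P\in\mathcal H$ is the Bochner integral. Definition (KLE). A Bochner integrable $v:\Omega\to\mathcal H$ admits a KLE if $$v=\mathbb E(v)+\sum_{r=1}^R\lambda_r^{1/2}Y_r\phi_r$$ where: (1) $R\in\{0,1,2,\dots\}\cup\{\aleph_0\}$, and if $R=\aleph_0$ the sum converges in the $L^2(\Omega,\mathcal H)$ norm; (2) $\lambda_r\in(0,\infty)$,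 $\lambda_1\ge\lambda_2\ge\cdots$, and $\sum_{r=1}^R\lambda_r=\|v-\mathbb E(v)\|^2_{L^2(\Omega,\mathcal H)}$; (3) $\{Y_r\}_{r=1}^R$ is an orthonormal set in $L^2(\Omega)$ with each $Y_r$ of mean zero; (4) $\{\phi_r\}_{r=1}^R$ is an orthonormal set in $\mathcal H$. Here $Y_r\phi_r$ denotes the function $\omega\mapsto Y_r(\omega)\phi_r$, and the empty sum ($R=0$) is $0$. *)

theory Defs
  imports "HOL-Probability.Probability"
begin

text \<open>
  The library's Bochner integral is restricted to second countable spaces. A Hilbert space need
  not be separable, so measurability, integrability and the integral are introduced here through
  approximation by simple functions, without that restriction.

  Elements of \<open>L\<^sup>2\<close> are represented by functions; equations between them hold almost everywhere.
\<close>

definition simple_ae :: "'a measure \<Rightarrow> ('a \<Rightarrow> 'h::real_normed_vector) \<Rightarrow> bool" where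
  "simple_ae M v \<longleftrightarrow>
    (\<exists>(N::nat) E e. (\<forall>n<N. E n \<in> sets M) \<and>
       (AE \<omega> in M. v \<omega> = (\<Sum>n<N. indicator (E n) \<omega> *\<^sub>R e n)))"

definition bochner_measurable :: "'a measure \<Rightarrow> ('a \<Rightarrow> 'h::real_normed_vector) \<Rightarrow> bool" where
  "bochner_measurable M v \<longleftrightarrow>
    (\<exists>s. (\<forall>n::nat. simple_ae M (s n)) \<and>
       (AE \<omega> in M. (\<lambda>n. norm (s n \<omega> - v \<omega>)) \<longlonglongrightarrow> 0))"

text \<open>
  The approximating sequences are the same as in the library's \<^const>\<open>has_bochner_integral\<close>.
\<close>

definition bochner_approx ::
    "'a measure \<Rightarrow> ('a \<Rightarrow> 'h::real_normed_vector) \<Rightarrow> (nat \<Rightarrow> 'a \<Rightarrow> 'h) \<Rightarrow> bool" where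
  "bochner_approx M v s \<longleftrightarrow>
    (\<forall>n. Bochner_Integration.simple_bochner_integrable M (s n)) \<and>
    (\<lambda>n. \<integral>\<^sup>+\<omega>. ennreal (norm (v \<omega> - s n \<omega>)) \<partial>M) \<longlonglongrightarrow> 0"

definition bochner_integrable :: "'a measure \<Rightarrow> ('a \<Rightarrow> 'h::real_normed_vector) \<Rightarrow> bool" where
  "bochner_integrable M v \<longleftrightarrow> bochner_measurable M v \<and> (\<exists>s. bochner_approx M v s)"

definition bochner_integral :: "'a measure \<Rightarrow> ('a \<Rightarrow> 'h::real_normed_vector) \<Rightarrow> 'h" where
  "bochner_integral M v =
    (THE x. \<exists>s. bochner_approx M v s \<and>
       (\<lambda>n. Bochner_Integration.simple_bochner_integral M (s n)) \<longlonglongrightarrow> x)"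

text \<open>
  The square of the \<open>L\<^sup>2\<close> norm is extended-valued, so that it may be written down for functions
  that are not known to be square integrable.
\<close>

definition L2_norm_sq :: "'a measure \<Rightarrow> ('a \<Rightarrow> 'h::real_normed_vector) \<Rightarrow> ennreal" where
  "L2_norm_sq M v = (\<integral>\<^sup>+\<omega>. ennreal ((norm (v \<omega>))\<^sup>2) \<partial>M)"

definition L2_space :: "'a measure \<Rightarrow> ('a \<Rightarrow> 'h::real_normed_vector) set" where
  "L2_space M = {v. bochner_measurable M v \<and> L2_norm_sq M v < \<infinity>}"

definition L2_real :: "'a measure \<Rightarrow> ('a \<Rightarrow> real) set" where
  "L2_real M = {Y. Y \<in> borel_measurable M \<and> integrable M (\<lambda>\<omega>. (Y \<omega>)\<^sup>2)}"

text \<open>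
  Indices start at \<open>0\<close>, and \<open>R = \<infinity>\<close> stands for \<open>R = \<aleph>\<^sub>0\<close>; the families are only constrained at
  indices below \<open>R\<close>.
\<close>

definition KLE_partial_sum ::
    "(nat \<Rightarrow> real) \<Rightarrow> (nat \<Rightarrow> 'a \<Rightarrow> real) \<Rightarrow> (nat \<Rightarrow> 'h::real_normed_vector) \<Rightarrow> nat \<Rightarrow> 'a \<Rightarrow> 'h" where
  "KLE_partial_sum lam Y \<phi> N \<omega> = (\<Sum>r<N. (sqrt (lam r) * Y r \<omega>) *\<^sub>R \<phi> r)"

definition is_KLE ::
    "'a measure \<Rightarrow> ('a \<Rightarrow> 'h::real_inner) \<Rightarrow> enat \<Rightarrow> (nat \<Rightarrow> real) \<Rightarrow> (nat \<Rightarrow> 'a \<Rightarrow> real) \<Rightarrow>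
      (nat \<Rightarrow> 'h) \<Rightarrow> bool" where
  "is_KLE M v R lam Y \<phi> \<longleftrightarrow>
    (case R of
       enat N \<Rightarrow> AE \<omega> in M. v \<omega> = bochner_integral M v + KLE_partial_sum lam Y \<phi> N \<omega>
     | \<infinity> \<Rightarrow> (\<lambda>N. L2_norm_sq M
                (\<lambda>\<omega>. v \<omega> - (bochner_integral M v + KLE_partial_sum lam Y \<phi> N \<omega>))) \<longlonglongrightarrow> 0) \<and>
    (\<forall>r. enat r < R \<longrightarrow> 0 < lam r) \<and>
    (\<forall>r s. r \<le> s \<longrightarrow> enat s < R \<longrightarrow> lam s \<le> lam r) \<and>
    (\<Sum>r. if enat r < R then ennreal (lam r) else 0)
      = L2_norm_sq M (\<lambda>\<omega>. v \<omega> - bochner_integral M v) \<and>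
    (\<forall>r. enat r < R \<longrightarrow> Y r \<in> L2_real M \<and> (\<integral>\<omega>. Y r \<omega> \<partial>M) = 0) \<and>
    (\<forall>r s. enat r < R \<longrightarrow> enat s < R \<longrightarrow>
       (\<integral>\<omega>. Y r \<omega> * Y s \<omega> \<partial>M) = (if r = s then 1 else 0)) \<and>
    (\<forall>r s. enat r < R \<longrightarrow> enat s < R \<longrightarrow> \<phi> r \<bullet> \<phi> s = (if r = s then 1 else 0))"

definition admits_KLE :: "'a measure \<Rightarrow> ('a \<Rightarrow> 'h::real_inner) \<Rightarrow> bool" where
  "admits_KLE M v \<longleftrightarrow> (\<exists>R lam Y \<phi>. is_KLE M v R lam Y \<phi>)"

end

theory Submission
  imports Defs
begin

text \<open>
  For some partial sum \<open>S\<close> of the expansion, \<open>\<bbbE> v + S\<close> has finite \<open>L\<^sup>2\<close> distance from \<open>v\<close>: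
  for all sufficiently late ones if \<open>R = \<aleph>\<^sub>0\<close>, for the full sum if \<open>R\<close> is finite. By the Pythagorean theorem
  \<open>\<parallel>S \<omega>\<parallel>\<^sup>2 = \<Sum>r. \<lambda>\<^sub>r Y\<^sub>r(\<omega>)\<^sup>2\<close>, which is integrable, and constants are square
  integrable on a probability space. So \<open>v\<close> is a sum of three square integrable functions.

  The integral of \<open>\<parallel>v - (\<bbbE> v + S)\<parallel>\<^sup>2\<close> in \<^const>\<open>L2_norm_sq\<close> is a lower integral, the
  supremum over simple functions below the integrand. In place of a proof that the integrand is
  measurable, \<open>nn_integral_le_cmult_add\<close> supplies an inequality for lower integrals in which
  only the term \<open>\<parallel>\<bbbE> v\<parallel>\<^sup>2 + \<parallel>S\<parallel>\<^sup>2\<close> has to be measurable.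
\<close>

text \<open>
  Lower integrals are superadditive in general, and it is the measurability of \<open>k\<close> that gives this
  direction: for a simple \<open>g \<le> h\<close> the function \<open>(g - k) / c\<close> is measurable and lies below \<open>f\<close>,
  and on measurable functions the integral is additive. Finiteness of \<open>k\<close> excludes the
  difference \<open>\<infinity> - \<infinity>\<close>, which is \<open>\<infinity>\<close> in \<^typ>\<open>ennreal\<close> and need not lie below \<open>c * f\<close>.
\<close>

lemma nn_integral_le_cmult_add:
  fixes f h k :: "'a \<Rightarrow> ennreal" and c :: real
  assumes k: "k \<in> borel_measurable M" and k_fin: "\<And>x. k x < \<infinity>" and c: "0 < c"
    and le: "\<And>x. h x \<le> ennreal c * f x + k x"
  shows "(\<integral>\<^sup>+x. h x \<partial>M) \<le> ennreal c * (\<integral>\<^sup>+x. f x \<partial>M) + (\<integral>\<^sup>+x. k x \<partial>M)"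
proof -
  have c_inv: "ennreal c * ennreal (inverse c) = 1"
    using c by (simp flip: ennreal_mult)
  have simple: "integral\<^sup>S M g \<le> ennreal c * (\<integral>\<^sup>+x. f x \<partial>M) + (\<integral>\<^sup>+x. k x \<partial>M)"
    if g: "simple_function M g" and gh: "g \<le> h" for g
  proof -
    define d where "d x = ennreal (inverse c) * (g x - k x)" for x
    have [measurable]: "g \<in> borel_measurable M" "k \<in> borel_measurable M"
      using g k by (auto intro: borel_measurable_simple_function)
    have [measurable]: "d \<in> borel_measurable M"
      unfolding d_def by measurable
    have d_le: "d x \<le> f x" for x
    proof -
      have "g x \<le> k x + ennreal c * f x"
        using gh le[of x] by (metis add.commute le_funD order_trans)
      then have "g x - k x \<le> ennreal c * f x"
        using k_fin[of x] by (auto simp: ennreal_minus_le_iff)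
      then have "d x \<le> ennreal (inverse c) * (ennreal c * f x)"
        unfolding d_def by (rule mult_left_mono) simp
      also have "\<dots> = f x"
        using c_inv by (metis mult.assoc mult.commute mult_1)
      finally show ?thesis .
    qed
    have g_le: "g x \<le> ennreal c * d x + k x" for x
    proof -
      have "ennreal c * d x = g x - k x"
        unfolding d_def using c_inv by (metis mult.assoc mult_1)
      then show ?thesis
        by (metis add.commute ennreal_minus_le_iff order_refl)
    qed
    have "integral\<^sup>S M g = (\<integral>\<^sup>+x. g x \<partial>M)"
      using g by (simp add: nn_integral_eq_simple_integral)
    also have "\<dots> \<le> (\<integral>\<^sup>+x. ennreal c * d x + k x \<partial>M)"
      by (intro nn_integral_mono g_le)
    also have "\<dots> = ennreal c * (\<integral>\<^sup>+x. d x \<partial>M) + (\<integral>\<^sup>+x. k x \<partial>M)"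
      by (simp add: nn_integral_add nn_integral_cmult)
    also have "\<dots> \<le> ennreal c * (\<integral>\<^sup>+x. f x \<partial>M) + (\<integral>\<^sup>+x. k x \<partial>M)"
      by (intro add_right_mono mult_left_mono nn_integral_mono d_le) simp
    finally show ?thesis .
  qed
  show ?thesis
    unfolding nn_integral_def[of M h] by (rule SUP_least) (use simple in auto)
qed

lemma norm_KLE_partial_sum_sq:
  fixes \<phi> :: "nat \<Rightarrow> 'h::real_inner"
  assumes lam: "\<And>r. r < N \<Longrightarrow> 0 \<le> lam r"
    and ortho: "\<And>r s. r < N \<Longrightarrow> s < N \<Longrightarrow> \<phi> r \<bullet> \<phi> s = (if r = s then 1 else 0)"
  shows "(norm (KLE_partial_sum lam Y \<phi> N \<omega>))\<^sup>2 = (\<Sum>r<N. lam r * (Y r \<omega>)\<^sup>2)"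
proof -
  have "(norm (KLE_partial_sum lam Y \<phi> N \<omega>))\<^sup>2
      = (\<Sum>r<N. (norm ((sqrt (lam r) * Y r \<omega>) *\<^sub>R \<phi> r))\<^sup>2)"
    unfolding KLE_partial_sum_def
    by (rule norm_sum_Pythagorean) (auto simp: pairwise_def orthogonal_def ortho)
  also have "\<dots> = (\<Sum>r<N. lam r * (Y r \<omega>)\<^sup>2)"
  proof (rule sum.cong)
    fix r assume "r \<in> {..<N}"
    then have "norm (\<phi> r) = 1" "0 \<le> lam r"
      using ortho[of r r] lam[of r] by (auto simp: norm_eq_sqrt_inner)
    then show "(norm ((sqrt (lam r) * Y r \<omega>) *\<^sub>R \<phi> r))\<^sup>2 = lam r * (Y r \<omega>)\<^sup>2"
      by (simp add: power_mult_distrib)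
  qed simp
  finally show ?thesis .
qed

lemma norm_sq_triangle:
  fixes x y :: "'h::real_normed_vector"
  shows "(norm x)\<^sup>2 \<le> 2 * (norm (x - y))\<^sup>2 + 2 * (norm y)\<^sup>2"
proof -
  have "(norm x)\<^sup>2 \<le> (norm (x - y) + norm y)\<^sup>2"
    using norm_triangle_ineq[of "x - y" y] by (intro power_mono) auto
  also have "\<dots> \<le> 2 * (norm (x - y))\<^sup>2 + 2 * (norm y)\<^sup>2"
    using sum_squares_bound[of "norm (x - y)" "norm y"] by (simp add: power2_sum)
  finally show ?thesis .
qed

lemma is_KLE_partial_sum_at_finite_distance:
  assumes "is_KLE M v R lam Y \<phi>"
  obtains N where "enat N \<le> R"
    and "L2_norm_sq M (\<lambda>\<omega>. v \<omega> - (bochner_integral M v + KLE_partial_sum lam Y \<phi> N \<omega>)) < \<infinity>"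
proof (cases R)
  case (enat N)
  let ?d = "\<lambda>\<omega>. v \<omega> - (bochner_integral M v + KLE_partial_sum lam Y \<phi> N \<omega>)"
  have "AE \<omega> in M. ?d \<omega> = 0"
    using assms enat by (simp add: is_KLE_def)
  then have "L2_norm_sq M ?d = (\<integral>\<^sup>+\<omega>. 0 \<partial>M)"
    unfolding L2_norm_sq_def by (intro nn_integral_cong_AE) auto
  then show ?thesis
    using that[of N] enat by simp
next
  case infinity
  let ?L = "\<lambda>N. L2_norm_sq M
    (\<lambda>\<omega>. v \<omega> - (bochner_integral M v + KLE_partial_sum lam Y \<phi> N \<omega>))"
  have "?L \<longlonglongrightarrow> 0"
    using assms infinity by (simp add: is_KLE_def)
  then have "eventually (\<lambda>N. ?L N < \<infinity>) sequentially"
    by (rule order_tendstoD) simp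
  then show ?thesis
    using that infinity by (auto simp: eventually_sequentially)
qed

theorem mainTheorem2:
  fixes M :: "'a measure" and v :: "'a \<Rightarrow> 'h::{real_inner, complete_space}"
  assumes "prob_space M" and "complete_measure M"
    and "bochner_integrable M v"
    and "admits_KLE M v"
  shows "v \<in> L2_space M"
proof -
  interpret prob_space M by fact
  obtain R lam Y \<phi> where KLE: "is_KLE M v R lam Y \<phi>"
    using \<open>admits_KLE M v\<close> by (auto simp: admits_KLE_def)
  then obtain N where N: "enat N \<le> R"
    and fin: "L2_norm_sq M
      (\<lambda>\<omega>. v \<omega> - (bochner_integral M v + KLE_partial_sum lam Y \<phi> N \<omega>)) < \<infinity>"
    by (rule is_KLE_partial_sum_at_finite_distance)
  define m where "m = bochner_integral M v"
  define S where "S = KLE_partial_sum lam Y \<phi> N"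
  define q where "q \<omega> = 4 * (norm m)\<^sup>2 + 4 * (\<Sum>r<N. lam r * (Y r \<omega>)\<^sup>2)" for \<omega>
  have below: "enat r < R" if "r < N" for r
    using that N by (meson enat_ord_simps(2) less_le_trans)
  have lam: "0 \<le> lam r" and Y: "integrable M (\<lambda>\<omega>. (Y r \<omega>)\<^sup>2)" if "r < N" for r
    using KLE below[OF that] by (auto simp: is_KLE_def L2_real_def less_imp_le)
  have ortho: "\<phi> r \<bullet> \<phi> s = (if r = s then 1 else 0)" if "r < N" "s < N" for r s
    using KLE below that by (simp add: is_KLE_def)
  have q: "integrable M q"
    unfolding q_def using Y
    by (intro Bochner_Integration.integrable_add integrable_mult_right
        Bochner_Integration.integrable_sum) auto
  have q_nonneg: "0 \<le> q \<omega>" for \<omega>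
    unfolding q_def using lam by (auto intro!: add_nonneg_nonneg sum_nonneg)
  have bound: "(norm (v \<omega>))\<^sup>2 \<le> 2 * (norm (v \<omega> - (m + S \<omega>)))\<^sup>2 + q \<omega>" for \<omega>
  proof -
    have "(norm (S \<omega>))\<^sup>2 = (\<Sum>r<N. lam r * (Y r \<omega>)\<^sup>2)"
      unfolding S_def using lam ortho by (rule norm_KLE_partial_sum_sq)
    then show ?thesis
      unfolding q_def
      using norm_sq_triangle[of "v \<omega>" "m + S \<omega>"] norm_sq_triangle[of "m + S \<omega>" "S \<omega>"] by simp
  qed
  have "L2_norm_sq M v \<le> ennreal 2 * L2_norm_sq M (\<lambda>\<omega>. v \<omega> - (m + S \<omega>))
      + (\<integral>\<^sup>+\<omega>. ennreal (q \<omega>) \<partial>M)"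
    unfolding L2_norm_sq_def
  proof (rule nn_integral_le_cmult_add)
    show "(\<lambda>\<omega>. ennreal (q \<omega>)) \<in> borel_measurable M"
      using q by measurable
    show "ennreal ((norm (v \<omega>))\<^sup>2)
        \<le> ennreal 2 * ennreal ((norm (v \<omega> - (m + S \<omega>)))\<^sup>2) + ennreal (q \<omega>)" for \<omega>
      using bound[of \<omega>] q_nonneg[of \<omega>]
      by (subst ennreal_mult[symmetric], simp, simp, subst ennreal_plus[symmetric])
        (auto intro: ennreal_leI simp del: ennreal_plus)
  qed simp_all
  also have "(\<integral>\<^sup>+\<omega>. ennreal (q \<omega>) \<partial>M) = ennreal (\<integral>\<omega>. q \<omega> \<partial>M)"
    using q q_nonneg by (simp add: nn_integral_eq_integral)
  also have "ennreal 2 * L2_norm_sq M (\<lambda>\<omega>. v \<omega> - (m + S \<omega>)) + ennreal (\<integral>\<omega>. q \<omega> \<partial>M) < \<infinity>"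
    using fin by (simp add: m_def S_def ennreal_mult_less_top)
  finally show ?thesis
    using \<open>bochner_integrable M v\<close> by (simp add: L2_space_def bochner_integrable_def)
qed

end
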